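(* Let $A = \{ a \in N : p(a u_k - a) + p(u_k a - a) \to 0 \text{ as } k \to \infty\}$. Then $A$ is not weakly compact, and $A$ is not separable.
   Context: A Banach algebra $A$ is called weakly compact if for every $a \in A$ the map $A \to A$, $x \mapsto axa$, is a weakly compact operator. Here $\mathbb{N}=\{1,2,\dots\}$, $\mathbb{N}_0 = \mathbb{N}\cup\{0\}$, $M_n=M_n(\mathbb{C})$ with operator norm $\|\cdot\|$. Let $(c_n)$ be an unbounded increasing sequence in $(0,\infty)$. Let $d_n \in M_n$ be the diagonal matrix whose $k$th diagonal entry is $c_n^k$. Let $M$ be the von Neumann algebra $\oplus_n^\infty (M_n \oplus M_n)$ ($\ell^\infty$-direct sum), and let $N \subset M$ be the weak*-closed unital subalgebra of all tuples $((x_n, d_n x_n d_n^{-1}))_n$ that lie in $M$, with $(x_n) \in \oplus_n^\infty M_n$; such a tuple is also written simply $(x_n)$. The norm on $N$ is $p((x_n)) = \sup_n p_n(x_n)$, where $p_n(x) = \max\{\|x\|, \|d_n x d_n^{-1}\|\}$ for $x \in M_n$. Let $L_n \in M_n$ be the left shift on $\mathbb{C}^n$ ($L_n e_1 = 0$, $L_n e_{j+1} = e_j$). For $n \ge k$ put $E_{n,k} = \mathbb{N}_0 \cap [\frac{n}{k}, \frac{2n}{k}]$, $\mu_{n,k} = |E_{n,k}|$, and $u_{n,k} = \frac{1}{\mu_{n,k}} \sum_{i \in E_{n,k}} (L_n)^i$; for $n < k$ put $u_{n,k} = I_n$. Set $u_k = (u_{n,k})_{n \in \mathbb{N}} \in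 N$. *)

theory Defs
  imports
    "HOL-Analysis.Abstract_Topological_Spaces"
    "HOL-Analysis.L2_Norm"
    "Jordan_Normal_Form.Matrix"
begin

section \<open>Complex normed algebras given by a carrier set\<close>

text \<open>
  The algebras considered here need not have a unit, and the carriers depend on a parameter, so
  neither the type class of Banach algebras nor the unital ring records are applicable.
  The values of the operations outside the carrier are irrelevant.
\<close>

record 'a normed_algebra =
  carr :: "'a set"
  add :: "'a \<Rightarrow> 'a \<Rightarrow> 'a"
  scl :: "complex \<Rightarrow> 'a \<Rightarrow> 'a"
  mul :: "'a \<Rightarrow> 'a \<Rightarrow> 'a"
  nrm :: "'a \<Rightarrow> real"

definition bounded_functionals :: "'a normed_algebra \<Rightarrow> ('a \<Rightarrow> complex) set" where
  "bounded_functionals E = {\<phi>.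
     (\<forall>x\<in>carr E. \<forall>y\<in>carr E. \<phi> (add E x y) = \<phi> x + \<phi> y) \<and>
     (\<forall>a. \<forall>x\<in>carr E. \<phi> (scl E a x) = a * \<phi> x) \<and>
     (\<exists>C. \<forall>x\<in>carr E. cmod (\<phi> x) \<le> C * nrm E x)}"

definition weak_topology :: "'a normed_algebra \<Rightarrow> 'a topology" where
  "weak_topology E =
     topology_generated_by {{x \<in> carr E. \<phi> x \<in> U} | \<phi> U. \<phi> \<in> bounded_functionals E \<and> open U}"

definition norm_topology :: "'a normed_algebra \<Rightarrow> 'a topology" where
  "norm_topology E =
     topology_generated_by {{y \<in> carr E. nrm E (add E y (scl E (-1) x)) < r} | x r. x \<in> carr E}"

definition separable_algebra :: "'a normed_algebra \<Rightarrow> bool" where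
  "separable_algebra E \<longleftrightarrow> separable_space (norm_topology E)"

text \<open>
  The image of the closed unit ball is relatively compact in the weak topology. The predicate is
  meant for bounded linear maps of \<open>carr E\<close> into itself; these conditions are not made part
  of it, so that its negation speaks about the compactness only. The same applies to the Banach
  algebra axioms in \<open>weakly_compact_algebra\<close>.
\<close>

definition weakly_compact_operator :: "'a normed_algebra \<Rightarrow> ('a \<Rightarrow> 'a) \<Rightarrow> bool" where
  "weakly_compact_operator E T \<longleftrightarrow>
     compactin (weak_topology E)
       (weak_topology E closure_of (T ` {x \<in> carr E. nrm E x \<le> 1}))"

definition weakly_compact_algebra :: "'a normed_algebra \<Rightarrow> bool" where
  "weakly_compact_algebra E \<longleftrightarrow>
     (\<forall>a\<in>carr E. weakly_compact_operator E (\<lambda>x. mul E (mul E a x) a))"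

section \<open>The algebra \<open>N\<close>\<close>

definition mat_opnorm :: "complex mat \<Rightarrow> real" where
  "mat_opnorm X =
     (SUP v \<in> {v \<in> carrier_vec (dim_col X). L2_set (\<lambda>i. cmod (v $ i)) {..<dim_col X} \<le> 1}.
        L2_set (\<lambda>i. cmod ((X *\<^sub>v v) $ i)) {..<dim_row X})"

text \<open>
  Matrix entries are indexed from 0, so the exponent at position \<open>k\<close> is \<open>k + 1\<close>.
\<close>

definition dmat :: "(nat \<Rightarrow> real) \<Rightarrow> nat \<Rightarrow> complex mat" where
  "dmat c n = mat_diag n (\<lambda>k. complex_of_real (c n ^ (k + 1)))"

definition dmat_inv :: "(nat \<Rightarrow> real) \<Rightarrow> nat \<Rightarrow> complex mat" where
  "dmat_inv c n = mat_diag n (\<lambda>k. complex_of_real (inverse (c n ^ (k + 1))))"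

lemma dmat_inverse:
  assumes "c n \<noteq> 0"
  shows "dmat c n * dmat_inv c n = 1\<^sub>m n" and "dmat_inv c n * dmat c n = 1\<^sub>m n"
  using assms by (simp_all add: dmat_def dmat_inv_def del: power_Suc)

definition p_block :: "(nat \<Rightarrow> real) \<Rightarrow> nat \<Rightarrow> complex mat \<Rightarrow> real" where
  "p_block c n X = max (mat_opnorm X) (mat_opnorm (dmat c n * X * dmat_inv c n))"

text \<open>
  Sequences indexed by the positive integers are functions on \<open>nat\<close>. Their value at \<open>0\<close> is
  forced to be the unique 0-by-0 matrix and therefore carries no information.
\<close>

definition linf_M :: "(nat \<Rightarrow> complex mat) set" where
  "linf_M = {x. (\<forall>n. x n \<in> carrier_mat n n) \<and> bdd_above ((\<lambda>n. mat_opnorm (x n)) ` {1..})}"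

definition linf_MM :: "(nat \<Rightarrow> complex mat \<times> complex mat) set" where
  "linf_MM = {z. (\<forall>n. z n \<in> carrier_mat n n \<times> carrier_mat n n) \<and>
     bdd_above ((\<lambda>n. max (mat_opnorm (fst (z n))) (mat_opnorm (snd (z n)))) ` {1..})}"

text \<open>
  The tuple \<open>(x\<^sub>n, d\<^sub>n x\<^sub>n d\<^sub>n\<inverse>)\<^sub>n\<close> is represented by its first components \<open>(x\<^sub>n)\<^sub>n\<close>.
\<close>

definition alg_N :: "(nat \<Rightarrow> real) \<Rightarrow> (nat \<Rightarrow> complex mat) normed_algebra" where
  "alg_N c = \<lparr>
     carr = {x \<in> linf_M. (\<lambda>n. (x n, dmat c n * x n * dmat_inv c n)) \<in> linf_MM},
     add = (\<lambda>x y n. x n + y n),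
     scl = (\<lambda>a x n. a \<cdot>\<^sub>m x n),
     mul = (\<lambda>x y n. x n * y n),
     nrm = (\<lambda>x. SUP n\<in>{1..}. p_block c n (x n))\<rparr>"

section \<open>The algebra \<open>A\<close>\<close>

definition left_shift :: "nat \<Rightarrow> complex mat" where
  "left_shift n = mat n n (\<lambda>(i, j). if j = i + 1 then 1 else 0)"

definition shift_exps :: "nat \<Rightarrow> nat \<Rightarrow> nat set" where
  "shift_exps n k = {i. real n / real k \<le> real i \<and> real i \<le> 2 * real n / real k}"

definition u_block :: "nat \<Rightarrow> nat \<Rightarrow> complex mat" where
  "u_block n k =
     (if n < k then 1\<^sub>m n
      else mat n n (\<lambda>(i, j). 1 / of_nat (card (shift_exps n k)) *
             (\<Sum>l\<in>shift_exps n k. (left_shift n ^\<^sub>m l) $$ (i, j))))"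

definition useq :: "nat \<Rightarrow> nat \<Rightarrow> complex mat" where
  "useq k = (\<lambda>n. u_block n k)"

definition alg_A :: "(nat \<Rightarrow> real) \<Rightarrow> (nat \<Rightarrow> complex mat) normed_algebra" where
  "alg_A c = (alg_N c)\<lparr>carr := {a \<in> carr (alg_N c).
     (\<lambda>k. nrm (alg_N c) (\<lambda>n. a n * useq k n - a n) + nrm (alg_N c) (\<lambda>n. useq k n * a n - a n))
       \<longlonglongrightarrow> 0}\<rparr>"

end

theory Submission
  imports Defs "HOL-Computational_Algebra.Polynomial"
begin

unbundle no vec_syntax

text \<open>
  Let \<open>\<phi>\<^sub>n(X)\<close> be the sum of the entries of \<open>X \<in> M\<^sub>n\<close> divided by \<open>n\<close>, so
  \<open>|\<phi>\<^sub>n(X)| \<le> \<parallel>X\<parallel>\<close>. The matrices \<open>u\<^sub>n\<^sub>,\<^sub>k\<close> are polynomials in the left shift, and for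
  \<open>c\<^sub>n \<ge> 1\<close> the norm \<open>p\<^sub>n\<close> of such a polynomial is at most the \<open>\<ell>\<^sup>1\<close> norm of its
  coefficients. Since the averaging window for \<open>k\<close> is much shorter than the one for \<open>m\<close>
  when \<open>k\<close> is large, \<open>u\<^sub>m u\<^sub>k - u\<^sub>m\<close> is small, which puts \<open>u\<^sub>m\<close> and all its restrictions to
  sets of indices into \<open>A\<close>. For \<open>m = 8\<close> both \<open>\<phi>\<^sub>n(u\<^sub>n\<^sub>,\<^sub>m)\<close> and \<open>\<phi>\<^sub>n(u\<^sub>n\<^sub>,\<^sub>m\<^sup>2)\<close> are at least
  \<open>1/2\<close>. The restrictions of \<open>u\<^sub>8\<close> to the various sets of indices are therefore uniformly
  separated, and \<open>A\<close> is not separable.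

  For \<open>a = u\<^sub>8\<close> let \<open>y\<^sub>j = a x\<^sub>j a\<close>, where \<open>x\<^sub>j\<close> is the identity in the blocks up to \<open>j\<close>
  and zero in the others. Let \<open>L\<close> be a generalized limit of the sequence \<open>(\<phi>\<^sub>n)\<^sub>n\<close>. The weakly
  open sets \<open>{L > 1/4}\<close> and \<open>{\<phi>\<^sub>n \<noteq> \<phi>\<^sub>n(a\<^sup>2)}\<close> cover \<open>A\<close>, but finitely many of them miss
  \<open>y\<^sub>j\<close> for large \<open>j\<close>.
\<close>

section \<open>The operator norm\<close>

lemma mat_opnorm_leI:
  assumes "\<And>v. v \<in> carrier_vec (dim_col X) \<Longrightarrow>
      L2_set (\<lambda>i. cmod (v $ i)) {..<dim_col X} \<le> 1 \<Longrightarrow>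
      L2_set (\<lambda>i. cmod ((X *\<^sub>v v) $ i)) {..<dim_row X} \<le> C"
  shows "mat_opnorm X \<le> C"
  unfolding mat_opnorm_def
proof (rule cSUP_least)
  have "0\<^sub>v (dim_col X) \<in> {v \<in> carrier_vec (dim_col X). L2_set (\<lambda>i. cmod (v $ i)) {..<dim_col X} \<le> 1}"
    by (simp add: L2_set_def)
  then show "{v \<in> carrier_vec (dim_col X). L2_set (\<lambda>i. cmod (v $ i)) {..<dim_col X} \<le> 1} \<noteq> {}"
    by blast
qed (use assms in auto)

text \<open>A real supremum is informative only over a set that is bounded above. The sum of the
  moduli of all entries is a crude bound that suffices here.\<close>

lemma L2_le_mat_opnorm:
  assumes "v \<in> carrier_vec (dim_col X)" "L2_set (\<lambda>i. cmod (v $ i)) {..<dim_col X} \<le> 1"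
  shows "L2_set (\<lambda>i. cmod ((X *\<^sub>v v) $ i)) {..<dim_row X} \<le> mat_opnorm X"
proof -
  have "L2_set (\<lambda>i. cmod ((X *\<^sub>v w) $ i)) {..<dim_row X}
        \<le> (\<Sum>i<dim_row X. \<Sum>j<dim_col X. cmod (X $$ (i, j)))"
    if w: "w \<in> carrier_vec (dim_col X)" "L2_set (\<lambda>i. cmod (w $ i)) {..<dim_col X} \<le> 1" for w
  proof -
    have w1: "cmod (w $ j) \<le> 1" if "j < dim_col X" for j
      using member_le_L2_set[of "{..<dim_col X}" j "\<lambda>i. cmod (w $ i)"] that w(2) by simp
    have "L2_set (\<lambda>i. cmod ((X *\<^sub>v w) $ i)) {..<dim_row X} \<le> (\<Sum>i<dim_row X. cmod ((X *\<^sub>v w) $ i))"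
      by (rule L2_set_le_sum) simp
    also have "\<dots> \<le> (\<Sum>i<dim_row X. \<Sum>j<dim_col X. cmod (X $$ (i, j)))"
    proof (rule sum_mono)
      fix i assume i: "i \<in> {..<dim_row X}"
      have "cmod ((X *\<^sub>v w) $ i) = cmod (\<Sum>j<dim_col X. X $$ (i, j) * w $ j)"
        using i w(1) by (auto simp: scalar_prod_def atLeast0LessThan intro!: arg_cong[where f=cmod] sum.cong)
      also have "\<dots> \<le> (\<Sum>j<dim_col X. cmod (X $$ (i, j)) * cmod (w $ j))"
        by (rule order_trans[OF norm_sum]) (simp add: norm_mult)
      also have "\<dots> \<le> (\<Sum>j<dim_col X. cmod (X $$ (i, j)))"
        using w1 by (intro sum_mono mult_left_le) auto
      finally show "cmod ((X *\<^sub>v w) $ i) \<le> (\<Sum>j<dim_col X. cmod (X $$ (i, j)))" .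
    qed
    finally show ?thesis .
  qed
  then show ?thesis
    unfolding mat_opnorm_def using assms
    by (intro cSUP_upper) (auto intro!: bdd_aboveI2)
qed

lemma mat_opnorm_nonneg: "0 \<le> mat_opnorm X"
  using L2_le_mat_opnorm[of "0\<^sub>v (dim_col X)" X] L2_set_nonneg order_trans
  by (fastforce simp: L2_set_def)

lemma mat_opnorm_add_le:
  assumes "X \<in> carrier_mat m n" "Y \<in> carrier_mat m n"
  shows "mat_opnorm (X + Y) \<le> mat_opnorm X + mat_opnorm Y"
proof (rule mat_opnorm_leI)
  fix v assume v: "v \<in> carrier_vec (dim_col (X + Y))"
    "L2_set (\<lambda>i. cmod (v $ i)) {..<dim_col (X + Y)} \<le> 1"
  have "L2_set (\<lambda>i. cmod (((X + Y) *\<^sub>v v) $ i)) {..<dim_row (X + Y)}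
      \<le> L2_set (\<lambda>i. cmod ((X *\<^sub>v v) $ i) + cmod ((Y *\<^sub>v v) $ i)) {..<m}"
    using assms v add_mult_distrib_mat_vec[OF assms, of v]
    by (auto intro!: L2_set_mono norm_triangle_ineq)
  also have "\<dots> \<le> L2_set (\<lambda>i. cmod ((X *\<^sub>v v) $ i)) {..<m} + L2_set (\<lambda>i. cmod ((Y *\<^sub>v v) $ i)) {..<m}"
    by (rule L2_set_triangle_ineq)
  also have "\<dots> \<le> mat_opnorm X + mat_opnorm Y"
    using L2_le_mat_opnorm[of v X] L2_le_mat_opnorm[of v Y] assms v by auto
  finally show "L2_set (\<lambda>i. cmod (((X + Y) *\<^sub>v v) $ i)) {..<dim_row (X + Y)} \<le> \<dots>" .
qed

lemma mat_opnorm_smult_le: "mat_opnorm (a \<cdot>\<^sub>m X) \<le> cmod a * mat_opnorm X"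
proof (rule mat_opnorm_leI)
  fix v assume v: "v \<in> carrier_vec (dim_col (a \<cdot>\<^sub>m X))"
    "L2_set (\<lambda>i. cmod (v $ i)) {..<dim_col (a \<cdot>\<^sub>m X)} \<le> 1"
  have "L2_set (\<lambda>i. cmod (((a \<cdot>\<^sub>m X) *\<^sub>v v) $ i)) {..<dim_row (a \<cdot>\<^sub>m X)}
      = L2_set (\<lambda>i. cmod a * cmod ((X *\<^sub>v v) $ i)) {..<dim_row X}"
    using v by (auto intro!: L2_set_cong simp: scalar_prod_def norm_mult sum_distrib_left mult.assoc
        simp flip: norm_mult)
  also have "\<dots> = cmod a * L2_set (\<lambda>i. cmod ((X *\<^sub>v v) $ i)) {..<dim_row X}"
    by (simp add: L2_set_right_distrib)
  also have "\<dots> \<le> cmod a * mat_opnorm X"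
    using v by (intro mult_left_mono L2_le_mat_opnorm) auto
  finally show "L2_set (\<lambda>i. cmod (((a \<cdot>\<^sub>m X) *\<^sub>v v) $ i)) {..<dim_row (a \<cdot>\<^sub>m X)} \<le> \<dots>" .
qed

text \<open>Minkowski's inequality for finitely many summands; for infinite \<open>B\<close> both
  sums are zero by convention.\<close>

lemma L2_set_sum_le: "L2_set (\<lambda>i. \<Sum>l\<in>B. f l i) A \<le> (\<Sum>l\<in>B. L2_set (f l) A)"
proof (induction B rule: infinite_finite_induct)
  case (insert l B)
  then show ?case
    using L2_set_triangle_ineq[of "f l" "\<lambda>i. \<Sum>l\<in>B. f l i" A] by simp
qed (simp_all add: L2_set_def)

section \<open>Averaging the matrix entries\<close>

definition entry_avg :: "nat \<Rightarrow> complex mat \<Rightarrow> complex" where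
  "entry_avg n X = (\<Sum>i<n. \<Sum>j<n. X $$ (i, j)) / of_nat n"

lemma entry_avg_add:
  "\<lbrakk>X \<in> carrier_mat n n; Y \<in> carrier_mat n n\<rbrakk> \<Longrightarrow> entry_avg n (X + Y) = entry_avg n X + entry_avg n Y"
  by (simp add: entry_avg_def sum.distrib add_divide_distrib)

lemma entry_avg_smult:
  "X \<in> carrier_mat n n \<Longrightarrow> entry_avg n (a \<cdot>\<^sub>m X) = a * entry_avg n X"
  by (simp add: entry_avg_def sum_distrib_left)

lemma entry_avg_zero [simp]: "entry_avg n (0\<^sub>m n n) = 0"
  by (simp add: entry_avg_def)

text \<open>With the unit vector \<open>v = (1, \<dots>, 1) / sqrt n\<close> the average is the inner product of \<open>X v\<close> and \<open>v\<close>.\<close>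

lemma norm_entry_avg_le:
  assumes X: "X \<in> carrier_mat n n"
  shows "cmod (entry_avg n X) \<le> mat_opnorm X"
proof (cases "n = 0")
  case True
  then show ?thesis by (simp add: entry_avg_def mat_opnorm_nonneg)
next
  case False
  define s where "s = inverse (sqrt (real n))"
  define v where "v = vec n (\<lambda>_. complex_of_real s)"
  have "sqrt (real n) * sqrt (real n) = real n" by simp
  then have s: "s > 0" "s * s * real n = 1"
    using False by (auto simp: s_def simp flip: inverse_mult_distrib)
  have s1: "L2_set (\<lambda>i. s) {..<n} = 1"
    using False by (simp add: L2_set_constant s_def)
  have vL: "L2_set (\<lambda>i. cmod (v $ i)) {..<n} = 1"
    unfolding s1[symmetric] using s by (intro L2_set_cong) (auto simp: v_def)
  have Xv: "(X *\<^sub>v v) $ i = s * (\<Sum>j<n. X $$ (i, j))" if "i < n" for i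
    using that X by (auto simp: v_def scalar_prod_def sum_distrib_left atLeast0LessThan mult.commute intro!: sum.cong)
  have "entry_avg n X = (\<Sum>i<n. s * (X *\<^sub>v v) $ i)"
  proof -
    have "(\<Sum>i<n. s * (X *\<^sub>v v) $ i) = of_real (s * s) * (\<Sum>i<n. \<Sum>j<n. X $$ (i, j))"
      by (simp add: Xv sum_distrib_left mult.assoc)
    also have "s * s = 1 / real n" using s False by (simp add: field_simps)
    finally show ?thesis by (simp add: entry_avg_def)
  qed
  then have "cmod (entry_avg n X) \<le> (\<Sum>i<n. \<bar>s\<bar> * \<bar>cmod ((X *\<^sub>v v) $ i)\<bar>)"
    using norm_sum[of "\<lambda>i. s * (X *\<^sub>v v) $ i" "{..<n}"] by (simp add: norm_mult)
  also have "\<dots> \<le> L2_set (\<lambda>i. s) {..<n} * L2_set (\<lambda>i. cmod ((X *\<^sub>v v) $ i)) {..<n}"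
    by (rule L2_set_mult_ineq)
  also have "\<dots> \<le> mat_opnorm X"
    using L2_le_mat_opnorm[of v X] X vL s1 by (simp add: v_def)
  finally show ?thesis .
qed

section \<open>Upper triangular Toeplitz matrices\<close>

text \<open>This is the sum of \<open>w l\<close> times the \<open>l\<close>-th power of the left
  shift; \<open>w l\<close> sits on the \<open>l\<close>-th superdiagonal, and values with
  \<open>l \<ge> n\<close> do not enter.\<close>

definition toeplitz :: "nat \<Rightarrow> (nat \<Rightarrow> real) \<Rightarrow> complex mat" where
  "toeplitz n w = mat n n (\<lambda>(i, j). if i \<le> j then complex_of_real (w (j - i)) else 0)"

lemma toeplitz_carrier [simp]: "toeplitz n w \<in> carrier_mat n n"
  by (simp add: toeplitz_def)

lemma toeplitz_dim [simp]: "dim_row (toeplitz n w) = n" "dim_col (toeplitz n w) = n"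
  by (simp_all add: toeplitz_def)

text \<open>Substituting \<open>l = j - i\<close> turns a sum along a row into a sum over
  superdiagonals. The guard keeps the range of \<open>l\<close> independent of the row.\<close>

lemma sum_triangle_reindex:
  fixes f :: "nat \<Rightarrow> nat \<Rightarrow> 'a::comm_monoid_add"
  shows "(\<Sum>j<n. if i \<le> j then f (j - i) j else 0) = (\<Sum>l<n. if i + l < n then f l (i + l) else 0)"
proof -
  have "(\<Sum>j<n. if i \<le> j then f (j - i) j else 0) = (\<Sum>j\<in>{i..<n}. f (j - i) j)"
    by (rule sum.mono_neutral_cong_right) auto
  also have "\<dots> = (\<Sum>l<n - i. f l (i + l))"
    by (rule sum.reindex_bij_witness[of _ "\<lambda>l. i + l" "\<lambda>j. j - i"]) auto
  also have "\<dots> = (\<Sum>l<n. if i + l < n then f l (i + l) else 0)"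
    by (rule sum.mono_neutral_cong_left) auto
  finally show ?thesis .
qed

lemma toeplitz_mult_vec:
  assumes "v \<in> carrier_vec n" "i < n"
  shows "(toeplitz n w *\<^sub>v v) $ i = (\<Sum>l<n. if i + l < n then w l * v $ (i + l) else 0)"
proof -
  have "(toeplitz n w *\<^sub>v v) $ i = (\<Sum>j<n. if i \<le> j then w (j - i) * v $ j else 0)"
    using assms by (auto simp: toeplitz_def scalar_prod_def atLeast0LessThan intro!: sum.cong)
  then show ?thesis
    using sum_triangle_reindex[where f = "\<lambda>l j. of_real (w l) * v $ j" and i = i and n = n] by simp
qed

text \<open>Triangle inequality over the superdiagonals, since powers of the shift are
  contractions.\<close>

lemma mat_opnorm_toeplitz_le: "mat_opnorm (toeplitz n w) \<le> (\<Sum>l<n. \<bar>w l\<bar>)"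
proof (rule mat_opnorm_leI)
  fix v assume "v \<in> carrier_vec (dim_col (toeplitz n w))"
    "L2_set (\<lambda>i. cmod (v $ i)) {..<dim_col (toeplitz n w)} \<le> 1"
  then have v: "v \<in> carrier_vec n" "L2_set (\<lambda>i. cmod (v $ i)) {..<n} \<le> 1" by simp_all
  \<comment> \<open>\<open>g l\<close> lists the moduli of the coordinates of the
    \<open>l\<close>-fold shift of \<open>v\<close>.\<close>
  define g where "g = (\<lambda>l i. if i + l < n then cmod (v $ (i + l)) else 0)"
  have g: "L2_set (g l) {..<n} \<le> 1" for l
  proof -
    have "(\<Sum>i<n. (g l i)\<^sup>2) = (\<Sum>i<n - l. (cmod (v $ (i + l)))\<^sup>2)"
      unfolding g_def by (rule sum.mono_neutral_cong_right) auto
    also have "\<dots> = (\<Sum>j\<in>{l..<n}. (cmod (v $ j))\<^sup>2)"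
      by (rule sum.reindex_bij_witness[of _ "\<lambda>j. j - l" "\<lambda>i. i + l"]) auto
    also have "\<dots> \<le> (\<Sum>j<n. (cmod (v $ j))\<^sup>2)"
      by (rule sum_mono2) auto
    finally show ?thesis using v(2) by (simp add: L2_set_def)
  qed
  have "L2_set (\<lambda>i. cmod ((toeplitz n w *\<^sub>v v) $ i)) {..<n}
      \<le> L2_set (\<lambda>i. \<Sum>l<n. \<bar>w l\<bar> * g l i) {..<n}"
  proof (rule L2_set_mono)
    fix i assume "i \<in> {..<n}"
    then have "cmod ((toeplitz n w *\<^sub>v v) $ i)
        \<le> (\<Sum>l<n. cmod (if i + l < n then w l * v $ (i + l) else 0))"
      using v by (subst toeplitz_mult_vec) (auto intro: norm_sum)
    also have "\<dots> = (\<Sum>l<n. \<bar>w l\<bar> * g l i)"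
      by (rule sum.cong) (auto simp: g_def norm_mult)
    finally show "cmod ((toeplitz n w *\<^sub>v v) $ i) \<le> (\<Sum>l<n. \<bar>w l\<bar> * g l i)" .
  qed simp
  also have "\<dots> \<le> (\<Sum>l<n. L2_set (\<lambda>i. \<bar>w l\<bar> * g l i) {..<n})"
    by (rule L2_set_sum_le)
  also have "\<dots> \<le> (\<Sum>l<n. \<bar>w l\<bar>)"
    using g by (intro sum_mono) (simp add: mult_left_le flip: L2_set_right_distrib)
  finally show "L2_set (\<lambda>i. cmod ((toeplitz n w *\<^sub>v v) $ i)) {..<dim_row (toeplitz n w)}
      \<le> (\<Sum>l<n. \<bar>w l\<bar>)" by simp
qed

section \<open>Conjugation by the diagonal matrices\<close>

lemma dmat_conj_index:
  assumes "X \<in> carrier_mat n n" "i < n" "j < n"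
  shows "(dmat c n * X * dmat_inv c n) $$ (i, j) = c n ^ (i + 1) * X $$ (i, j) * inverse (c n ^ (j + 1))"
  using assms unfolding dmat_def dmat_inv_def
  by (simp add: mat_diag_mult_left[of _ n n] mat_diag_mult_right[of _ n n] del: power_Suc)

lemma dmat_conj_carrier [simp]: "dmat c n * X * dmat_inv c n \<in> carrier_mat n n"
  by (rule carrier_matI) (simp_all add: dmat_def dmat_inv_def mat_diag_def)

text \<open>Conjugation multiplies the entry at \<open>(i, j)\<close> by the power of
  \<open>c n\<close> with exponent \<open>i - j\<close>. This factor is constant on each
  superdiagonal, so the Toeplitz form survives.\<close>

lemma dmat_conj_toeplitz:
  assumes "0 < c n"
  shows "dmat c n * toeplitz n w * dmat_inv c n = toeplitz n (\<lambda>l. w l * inverse (c n) ^ l)"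
proof (rule eq_matI)
  fix i j assume ij: "i < dim_row (toeplitz n (\<lambda>l. w l * inverse (c n) ^ l))"
    "j < dim_col (toeplitz n (\<lambda>l. w l * inverse (c n) ^ l))"
  have "c n ^ (i + 1) * inverse (c n ^ (j + 1)) = inverse (c n) ^ (j - i)" if "i \<le> j"
  proof -
    have "c n ^ (j + 1) = c n ^ (i + 1) * c n ^ (j - i)" using that by (simp flip: power_add)
    then show ?thesis using assms by (simp add: power_inverse field_simps)
  qed
  then have *: "c n ^ (i + 1) * w (j - i) * inverse (c n ^ (j + 1)) = w (j - i) * inverse (c n) ^ (j - i)" if "i \<le> j"
    using that by (metis mult.commute mult.assoc)
  have ij': "i < n" "j < n" using ij by simp_all
  show "(dmat c n * toeplitz n w * dmat_inv c n) $$ (i, j) = toeplitz n (\<lambda>l. w l * inverse (c n) ^ l) $$ (i, j)"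
  proof (cases "i \<le> j")
    case True
    then show ?thesis
      using ij' arg_cong[OF *[OF True], of complex_of_real]
      by (subst dmat_conj_index) (auto simp: toeplitz_def)
  qed (use ij' in \<open>subst dmat_conj_index; auto simp: toeplitz_def\<close>)
qed (simp_all add: dmat_def dmat_inv_def mat_diag_def)

text \<open>For \<open>c n \<ge> 1\<close> conjugation shrinks every superdiagonal. The second
  alternative covers multiples of the identity in the early blocks, where \<open>c n\<close> may be
  below 1.\<close>

lemma p_block_toeplitz_le:
  assumes "0 < c n" "c n \<ge> 1 \<or> (\<forall>l>0. w l = 0)"
  shows "p_block c n (toeplitz n w) \<le> (\<Sum>l<n. \<bar>w l\<bar>)"
proof -
  have "\<bar>w l * inverse (c n) ^ l\<bar> \<le> \<bar>w l\<bar>" for l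
  proof (cases "l = 0 \<or> w l = 0")
    case False
    then have "inverse (c n) ^ l \<le> 1" using assms by (auto intro!: power_le_one simp: inverse_le_1_iff)
    then show ?thesis using assms by (simp add: abs_mult mult_left_le)
  qed auto
  then have "(\<Sum>l<n. \<bar>w l * inverse (c n) ^ l\<bar>) \<le> (\<Sum>l<n. \<bar>w l\<bar>)"
    by (rule sum_mono)
  then have "mat_opnorm (toeplitz n (\<lambda>l. w l * inverse (c n) ^ l)) \<le> (\<Sum>l<n. \<bar>w l\<bar>)"
    by (rule order_trans[OF mat_opnorm_toeplitz_le])
  then show ?thesis
    using mat_opnorm_toeplitz_le[of n w] dmat_conj_toeplitz[of c n w, OF assms(1)]
    by (simp add: p_block_def)
qed

text \<open>The polynomial \<open>q\<close> is evaluated at the left shift.\<close>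

abbreviation toeplitz_poly :: "nat \<Rightarrow> real poly \<Rightarrow> complex mat" where
  "toeplitz_poly n q \<equiv> toeplitz n (coeff q)"

lemma toeplitz_poly_diff: "toeplitz_poly n (q - r) = toeplitz_poly n q - toeplitz_poly n r"
  by (rule eq_matI) (auto simp: toeplitz_def)

lemma toeplitz_poly_1: "toeplitz_poly n 1 = 1\<^sub>m n"
  by (rule eq_matI) (auto simp: toeplitz_def)

text \<open>Evaluation at the shift is multiplicative: the entry at \<open>(i, j)\<close> is the
  convolution of the coefficients at degree \<open>j - i < n\<close>, so truncation does no harm.
  Products of such matrices therefore commute.\<close>

lemma toeplitz_poly_mult: "toeplitz_poly n (q * r) = toeplitz_poly n q * toeplitz_poly n r"
proof (rule eq_matI)
  fix i j assume "i < dim_row (toeplitz_poly n q * toeplitz_poly n r)"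
    "j < dim_col (toeplitz_poly n q * toeplitz_poly n r)"
  then have ij: "i < n" "j < n" by simp_all
  have "(toeplitz_poly n q * toeplitz_poly n r) $$ (i, j)
      = (\<Sum>k<n. if i \<le> k \<and> k \<le> j then of_real (coeff q (k - i) * coeff r (j - k)) else 0)"
    using ij by (auto simp: toeplitz_def scalar_prod_def atLeast0LessThan intro!: sum.cong)
  also have "\<dots> = (\<Sum>k\<in>{i..j}. of_real (coeff q (k - i) * coeff r (j - k)))"
    using ij by (intro sum.mono_neutral_cong_right) auto
  also have "\<dots> = toeplitz_poly n (q * r) $$ (i, j)"
  proof (cases "i \<le> j")
    case True
    have "(\<Sum>k\<in>{i..j}. coeff q (k - i) * coeff r (j - k)) = (\<Sum>l\<le>j - i. coeff q l * coeff r (j - i - l))"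
      using True by (intro sum.reindex_bij_witness[of _ "\<lambda>l. i + l" "\<lambda>k. k - i"]) auto
    then show ?thesis using ij True by (simp add: toeplitz_def coeff_mult flip: of_real_sum of_real_mult)
  qed (use ij in \<open>simp add: toeplitz_def\<close>)
  finally show "toeplitz_poly n (q * r) $$ (i, j) = (toeplitz_poly n q * toeplitz_poly n r) $$ (i, j)" ..
qed simp_all

lemma left_shift_pow: "left_shift n ^\<^sub>m l = toeplitz_poly n (monom 1 l)"
proof (induction l)
  case 0
  have "monom 1 0 = (1 :: real poly)" by (simp add: monom_0)
  then show ?case by (simp only: toeplitz_poly_1) (simp add: left_shift_def)
next
  case (Suc l)
  have "left_shift n = toeplitz_poly n (monom 1 1)"
    by (rule eq_matI) (auto simp: left_shift_def toeplitz_def)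
  with Suc have "left_shift n ^\<^sub>m Suc l = toeplitz_poly n (monom 1 l * monom 1 1)"
      by (simp only: pow_mat.simps toeplitz_poly_mult)
    then show ?case by (simp add: mult_monom del: coeff_monom pow_mat.simps)
qed

text \<open>In each row \<open>i < n - degree q\<close> all coefficients fit, so the row sums to
  \<open>poly q 1\<close>. These are at least half of the rows, and the others contribute
  nonnegative amounts.\<close>

lemma Re_entry_avg_toeplitz_poly:
  assumes "n > 0" "\<And>l. 0 \<le> coeff q l" "2 * degree q \<le> n"
  shows "poly q 1 / 2 \<le> Re (entry_avg n (toeplitz_poly n q))"
proof -
  have row: "(\<Sum>j<n. toeplitz_poly n q $$ (i, j)) = of_real (\<Sum>l<n. if i + l < n then coeff q l else 0)"
    if "i < n" for i
  proof -
    have "(\<Sum>j<n. toeplitz_poly n q $$ (i, j)) = of_real (\<Sum>j<n. if i \<le> j then coeff q (j - i) else 0)"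
      using that by (auto simp: toeplitz_def intro!: sum.cong)
    then show ?thesis using sum_triangle_reindex[where f = "\<lambda>l j. coeff q l" and i = i and n = n] by simp
  qed
  have full: "(\<Sum>l<n. if i + l < n then coeff q l else 0) = poly q 1" if "i < n - degree q" for i
  proof -
    have "(\<Sum>l<n. if i + l < n then coeff q l else 0) = (\<Sum>l\<le>degree q. coeff q l)"
      using that by (intro sum.mono_neutral_cong_right) (auto simp: coeff_eq_0)
    then show ?thesis by (simp add: poly_altdef)
  qed
  have p0: "0 \<le> poly q 1" using assms(2) by (simp add: poly_altdef sum_nonneg)
  have "real n / 2 * poly q 1 \<le> real (n - degree q) * poly q 1"
    using assms(3) p0 by (intro mult_right_mono) auto
  also have "\<dots> = (\<Sum>i<n - degree q. \<Sum>l<n. if i + l < n then coeff q l else 0)"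
    using full by simp
  also have "\<dots> \<le> (\<Sum>i<n. \<Sum>l<n. if i + l < n then coeff q l else 0)"
    using assms(2) by (intro sum_mono2 sum_nonneg) auto
  also have "\<dots> = real n * Re (entry_avg n (toeplitz_poly n q))"
  proof -
    have "entry_avg n (toeplitz_poly n q)
        = of_real ((\<Sum>i<n. \<Sum>l<n. if i + l < n then coeff q l else 0) / real n)"
      by (simp add: entry_avg_def row)
    then show ?thesis using \<open>n > 0\<close> by simp
  qed
  finally show ?thesis using \<open>n > 0\<close> by (simp add: field_simps)
qed

section \<open>Averages of powers of the shift\<close>

definition avg_poly :: "nat set \<Rightarrow> real poly" where
  "avg_poly E = smult (1 / card E) (\<Sum>l\<in>E. monom 1 l)"

lemma coeff_avg_poly: "finite E \<Longrightarrow> coeff (avg_poly E) l = (if l \<in> E then 1 / card E else 0)"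
  by (simp add: avg_poly_def coeff_sum sum.delta)

lemma poly_avg_poly_1: "\<lbrakk>finite E; E \<noteq> {}\<rbrakk> \<Longrightarrow> poly (avg_poly E) 1 = 1"
  by (simp add: avg_poly_def poly_sum poly_monom)

lemma degree_avg_poly_le: "\<lbrakk>finite E; E \<subseteq> {..m}\<rbrakk> \<Longrightarrow> degree (avg_poly E) \<le> m"
  by (rule degree_le) (auto simp: coeff_avg_poly)

text \<open>Coefficients from degree \<open>n\<close> on are left out because they do not reach an
  \<open>n\<close>-by-\<open>n\<close> matrix.\<close>

abbreviation ell1 :: "nat \<Rightarrow> real poly \<Rightarrow> real" where
  "ell1 n q \<equiv> \<Sum>l<n. \<bar>coeff q l\<bar>"

lemma ell1_sum_le: "ell1 n (\<Sum>i\<in>I. q i) \<le> (\<Sum>i\<in>I. ell1 n (q i))"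
proof -
  have "ell1 n (\<Sum>i\<in>I. q i) \<le> (\<Sum>l<n. \<Sum>i\<in>I. \<bar>coeff (q i) l\<bar>)"
    by (intro sum_mono) (simp add: coeff_sum sum_abs)
  then show ?thesis by (simp add: sum.swap[of _ I])
qed

lemma ell1_smult: "ell1 n (smult a q) = \<bar>a\<bar> * ell1 n q"
  by (simp add: abs_mult sum_distrib_left)

lemma ell1_monom_le: "ell1 n (monom 1 l) \<le> 1"
  by (simp add: if_distrib[of abs] cong: if_cong)

lemma ell1_avg_poly_le: "ell1 n (avg_poly E) \<le> 1"
proof -
  have "ell1 n (\<Sum>l\<in>E. monom 1 l) \<le> (\<Sum>l\<in>E. 1)"
    by (rule order_trans[OF ell1_sum_le]) (intro sum_mono ell1_monom_le)
  then have "ell1 n (\<Sum>l\<in>E. monom 1 l) \<le> card E" by simp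
  then show ?thesis
    \<comment> \<open>\<open>card E = 0\<close> covers both empty and infinite \<open>E\<close>; the
      average is then the zero polynomial.\<close>
    unfolding avg_poly_def ell1_smult by (cases "card E = 0") (simp_all add: field_simps)
qed

text \<open>Telescoping: all but \<open>i\<close> terms at each end of the window cancel.\<close>

lemma window_shift_diff:
  fixes x :: "'a::comm_ring_1"
  assumes "s \<le> t"
  shows "(\<Sum>e=s..t. x ^ e) * (x ^ i - 1) = (\<Sum>l<i. x ^ (l + Suc t) - x ^ (l + s))"
proof -
  \<comment> \<open>The factor \<open>x - 1\<close> of \<open>x ^ i - 1\<close> collapses the window
    to its two end terms; the remaining geometric sum of length \<open>i\<close> then spreads these
    out.\<close>
  have "(\<Sum>e=s..t. x ^ e) * (x ^ i - 1) = - ((1 - x) * (\<Sum>e=s..t. x ^ e)) * (\<Sum>l<i. x ^ l)"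
    unfolding power_diff_1_eq by (simp add: algebra_simps)
  also have "\<dots> = (\<Sum>l<i. x ^ l) * (x ^ Suc t - x ^ s)"
    by (subst sum_gp_multiplied[OF assms]) (simp add: algebra_simps)
  also have "\<dots> = (\<Sum>l<i. x ^ (l + Suc t) - x ^ (l + s))"
    unfolding sum_distrib_right right_diff_distrib power_add sum_subtractf by (rule refl)
  finally show ?thesis .
qed

text \<open>After telescoping, \<open>2 * i\<close> monomials are left, each of norm at most
  1.\<close>

lemma ell1_avg_poly_shift_diff:
  assumes "s \<le> t"
  shows "ell1 n (avg_poly {s..t} * (monom 1 i - 1)) \<le> 2 * real i / card {s..t}"
proof -
  have m: "monom 1 l = monom (1::real) 1 ^ l" for l by (simp add: monom_power)
  have "ell1 n ((\<Sum>e=s..t. monom 1 e) * (monom 1 i - 1))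
      = ell1 n (\<Sum>l<i. monom 1 (l + Suc t) - monom 1 (l + s))"
    using window_shift_diff[OF assms, of "monom (1::real) 1" i] by (simp only: m[symmetric])
  also have "\<dots> \<le> (\<Sum>l<i. ell1 n (monom 1 (l + Suc t) - monom 1 (l + s)))"
    by (rule ell1_sum_le)
  also have "\<dots> \<le> (\<Sum>l<i. ell1 n (monom 1 (l + Suc t)) + ell1 n (monom 1 (l + s)))"
    unfolding sum.distrib[symmetric] coeff_diff by (intro sum_mono abs_triangle_ineq4)
  also have "\<dots> \<le> (\<Sum>l<i. 1 + 1)"
    by (intro sum_mono add_mono ell1_monom_le)
  finally have *: "ell1 n ((\<Sum>e=s..t. monom 1 e) * (monom 1 i - 1)) \<le> 2 * real i" by simp
  have "ell1 n (avg_poly {s..t} * (monom 1 i - 1))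
      = ell1 n ((\<Sum>e=s..t. monom 1 e) * (monom 1 i - 1)) / card {s..t}"
    unfolding avg_poly_def mult_smult_left ell1_smult by simp
  also have "\<dots> \<le> 2 * real i / card {s..t}"
    by (rule divide_right_mono[OF *]) simp
  finally show ?thesis .
qed

text \<open>\<open>avg_poly F - 1\<close> is the average over \<open>i\<close> in \<open>F\<close>
  of \<open>monom 1 i - 1\<close>, so the estimate for a single shift carries over.\<close>

lemma ell1_avg_poly_absorb:
  assumes "s \<le> t" "finite F" "F \<noteq> {}" "\<And>i. i \<in> F \<Longrightarrow> real i \<le> m"
  shows "ell1 n (avg_poly {s..t} * avg_poly F - avg_poly {s..t}) \<le> 2 * m / card {s..t}"
proof -
  let ?a = "avg_poly {s..t}"
  have cF: "card F > 0" using assms by (simp add: card_gt_0_iff)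
  have "?a * avg_poly F - ?a = smult (1 / card F) (\<Sum>i\<in>F. ?a * (monom 1 i - 1))"
  proof -
    have "?a = smult (1 / card F) (smult (card F) ?a)" using cF by simp
    then have "?a * avg_poly F - ?a = smult (1 / card F) (?a * (\<Sum>i\<in>F. monom 1 i) - smult (card F) ?a)"
      by (simp add: avg_poly_def[of F] smult_diff_right)
    also have "?a * (\<Sum>i\<in>F. monom 1 i) - smult (card F) ?a = (\<Sum>i\<in>F. ?a * (monom 1 i - 1))"
      unfolding right_diff_distrib sum_subtractf sum_distrib_left[symmetric]
      by (simp add: of_nat_poly)
    finally show ?thesis .
  qed
  then have "ell1 n (?a * avg_poly F - ?a) = ell1 n (\<Sum>i\<in>F. ?a * (monom 1 i - 1)) / card F"
    by (simp only: ell1_smult) simp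
  also have "\<dots> \<le> (\<Sum>i\<in>F. 2 * m / card {s..t}) / card F"
  proof (intro divide_right_mono order_trans[OF ell1_sum_le] sum_mono)
    fix i assume "i \<in> F"
    then show "ell1 n (?a * (monom 1 i - 1)) \<le> 2 * m / card {s..t}"
      using assms(4) by (intro order_trans[OF ell1_avg_poly_shift_diff[OF assms(1)]] divide_right_mono) auto
  qed simp
  also have "\<dots> = 2 * m / card {s..t}" using cF by simp
  finally show ?thesis .
qed

section \<open>The averaging windows and the polynomials of the blocks\<close>

lemma shift_exps_eq: "shift_exps n k = {nat \<lceil>real n / real k\<rceil>..nat \<lfloor>2 * real n / real k\<rfloor>}"
  by (auto simp: shift_exps_def nat_ceiling_le_eq le_nat_floor le_nat_iff le_floor_iff)

lemma finite_shift_exps [simp]: "finite (shift_exps n k)"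
  by (simp add: shift_exps_eq)

text \<open>A real interval from \<open>x\<close> to \<open>2 * x\<close> has length
  \<open>x\<close> and so contains more than \<open>x - 1\<close> integers.\<close>

lemma card_shift_exps_gt: "real n / real k - 1 < card (shift_exps n k)"
proof -
  define x where "x = real n / real k"
  have "0 \<le> x" and E: "shift_exps n k = {nat \<lceil>x\<rceil>..nat \<lfloor>2 * x\<rfloor>}"
    by (simp_all add: x_def shift_exps_eq)
  then have "real (nat \<lceil>x\<rceil>) < x + 1" "2 * x - 1 < real (nat \<lfloor>2 * x\<rfloor>)"
    by linarith+
  \<comment> \<open>As an inequality this also holds for an empty interval, so nonemptiness of the
    window can be deduced from it afterwards.\<close>
  moreover have "real t + 1 - real s \<le> card {s..t}" for s t :: nat
    by (cases "s \<le> Suc t") (auto simp: of_nat_diff)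
  from this[of "nat \<lfloor>2 * x\<rfloor>" "nat \<lceil>x\<rceil>"] have
    "real (nat \<lfloor>2 * x\<rfloor>) + 1 - real (nat \<lceil>x\<rceil>) \<le> card (shift_exps n k)" unfolding E .
  ultimately show ?thesis unfolding x_def by linarith
qed

lemma shift_exps_nonempty:
  assumes "1 \<le> k" "k \<le> n"
  shows "shift_exps n k \<noteq> {}"
proof -
  have "1 \<le> real n / real k" using assms by simp
  then have "0 < card (shift_exps n k)" using card_shift_exps_gt[of n k] by linarith
  then show ?thesis by (simp add: card_gt_0_iff)
qed

definition u_poly :: "nat \<Rightarrow> nat \<Rightarrow> real poly" where
  "u_poly n k = (if n < k then 1 else avg_poly (shift_exps n k))"

lemma u_block_eq: "u_block n k = toeplitz_poly n (u_poly n k)"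
proof (cases "n < k")
  case False
  show ?thesis
  proof (rule eq_matI)
    fix i j assume "i < dim_row (toeplitz_poly n (u_poly n k))" "j < dim_col (toeplitz_poly n (u_poly n k))"
    then show "u_block n k $$ (i, j) = toeplitz_poly n (u_poly n k) $$ (i, j)"
      using False by (simp add: u_block_def u_poly_def left_shift_pow toeplitz_def coeff_avg_poly sum.delta
          if_distrib[of complex_of_real] cong: if_cong)
  qed (use False in \<open>simp_all add: u_block_def\<close>)
qed (simp add: u_block_def u_poly_def toeplitz_poly_1)

lemma coeff_u_poly_nonneg: "0 \<le> coeff (u_poly n k) l"
  by (simp add: u_poly_def coeff_avg_poly)

lemma poly_u_poly_1:
  assumes "1 \<le> k"
  shows "poly (u_poly n k) 1 = 1"
  using shift_exps_nonempty[OF assms, of n] by (auto simp: u_poly_def intro!: poly_avg_poly_1)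

lemma degree_u_poly_le:
  assumes "1 \<le> k"
  shows "real (degree (u_poly n k)) \<le> 2 * real n / real k"
proof (cases "n < k")
  case False
  have "shift_exps n k \<subseteq> {..nat \<lfloor>2 * real n / real k\<rfloor>}" by (auto simp: shift_exps_eq)
  then have "degree (u_poly n k) \<le> nat \<lfloor>2 * real n / real k\<rfloor>"
    using False by (simp add: u_poly_def degree_avg_poly_le)
  moreover have "real (nat \<lfloor>2 * real n / real k\<rfloor>) \<le> 2 * real n / real k" by simp
  ultimately show ?thesis by linarith
qed (simp add: u_poly_def)

lemma ell1_u_poly_le: "ell1 n (u_poly n k) \<le> 1"
proof (cases "n < k")
  case True
  then show ?thesis
    using ell1_monom_le[where n = n and l = 0] by (simp only: u_poly_def True if_True monom_0 one_pCons)
qed (use ell1_avg_poly_le in \<open>simp add: u_poly_def\<close>)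

text \<open>The bound is uniform in \<open>n\<close>. For \<open>n < k\<close> the second factor is
  1 and the difference vanishes. Otherwise exponents of at most \<open>2 * n / k\<close> are
  absorbed by a window of at least \<open>n / (2 * m)\<close> elements.\<close>

lemma ell1_u_poly_absorb:
  assumes "1 \<le> m" "2 * m \<le> k"
  shows "ell1 n (u_poly n m * u_poly n k - u_poly n m) \<le> 8 * real m / real k"
proof (cases "n < k")
  case False
  define s t where "s = nat \<lceil>real n / real m\<rceil>" and "t = nat \<lfloor>2 * real n / real m\<rfloor>"
  have E: "shift_exps n m = {s..t}" by (simp add: shift_exps_eq s_def t_def)
  have mn: "m \<le> n" "1 \<le> k" "k \<le> n" using False assms by auto
  have "s \<le> t" using shift_exps_nonempty[of m n] mn assms by (simp add: E)
  then have "ell1 n (avg_poly {s..t} * avg_poly (shift_exps n k) - avg_poly {s..t})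
      \<le> 2 * (2 * real n / real k) / card {s..t}"
    using mn by (intro ell1_avg_poly_absorb shift_exps_nonempty finite_shift_exps) (simp_all add: shift_exps_def)
  also have "\<dots> \<le> 2 * (2 * real n / real k) / (real n / (2 * real m))"
  proof (intro divide_left_mono)
    \<comment> \<open>This makes \<open>n / m - 1\<close> at least \<open>n / (2 * m)\<close>, which
      removes the rounding loss in the window size.\<close>
    have "2 * real m \<le> real n" using mn assms by linarith
    then have "1 \<le> real n / (2 * real m)" using assms by (simp add: field_simps)
    moreover have "real n / real m = 2 * (real n / (2 * real m))" by simp
    ultimately show "real n / (2 * real m) \<le> card {s..t}"
      using card_shift_exps_gt[of n m] unfolding E by linarith
    then have "0 < real (card {s..t})"
      using \<open>1 \<le> real n / (2 * real m)\<close> by linarith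
    then show "0 < real (card {s..t}) * (real n / (2 * real m))"
      using \<open>1 \<le> real n / (2 * real m)\<close> by (intro mult_pos_pos) linarith+
  qed simp
  also have "\<dots> = 8 * real m / real k"
  proof -
    have "2 * (2 * a / b) / (a / (2 * d)) = 8 * d / b" if "a > 0" "b > 0" "d > 0" for a b d :: real
      using that by (simp add: field_simps)
    then show ?thesis using mn assms by auto
  qed
  finally show ?thesis using mn by (simp add: u_poly_def E)
qed (simp add: u_poly_def)

text \<open>The choice of 8 keeps the degree at most \<open>n / 4\<close>, so that even the square
  has degree at most \<open>n / 2\<close>.\<close>

lemma Re_entry_avg_u_block:
  assumes "1 \<le> n"
  shows "1 / 2 \<le> Re (entry_avg n (u_block n 8))" "1 / 2 \<le> Re (entry_avg n (u_block n 8 * u_block n 8))"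
proof -
  let ?u = "u_poly n 8"
  have p: "poly ?u 1 = 1" by (rule poly_u_poly_1) simp
  have d: "4 * degree ?u \<le> n" using degree_u_poly_le[of 8 n] by simp
  then show "1 / 2 \<le> Re (entry_avg n (u_block n 8))"
    using Re_entry_avg_toeplitz_poly[of n ?u] assms p by (simp add: u_block_eq coeff_u_poly_nonneg)
  have "degree (?u * ?u) \<le> 2 * degree ?u" using degree_mult_le[of ?u ?u] by simp
  moreover have "0 \<le> coeff (?u * ?u) l" for l
    by (simp add: coeff_mult sum_nonneg coeff_u_poly_nonneg)
  ultimately show "1 / 2 \<le> Re (entry_avg n (u_block n 8 * u_block n 8))"
    using Re_entry_avg_toeplitz_poly[of n "?u * ?u"] assms p d
    by (simp add: u_block_eq flip: toeplitz_poly_mult)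
qed

section \<open>Generalized limits\<close>

text \<open>A cluster point, in the compact product of the closures of the ranges, of the evaluations at
  the natural numbers.\<close>

lemma generalized_limit_exists:
  obtains \<Lambda> :: "(nat \<Rightarrow> complex) \<Rightarrow> complex" where
    "\<And>f g. \<lbrakk>bounded (range f); bounded (range g)\<rbrakk> \<Longrightarrow> \<Lambda> (\<lambda>n. f n + g n) = \<Lambda> f + \<Lambda> g"
    "\<And>a f. bounded (range f) \<Longrightarrow> \<Lambda> (\<lambda>n. a * f n) = a * \<Lambda> f"
    "\<And>f S. \<lbrakk>bounded (range f); closed S; eventually (\<lambda>n. f n \<in> S) sequentially\<rbrakk> \<Longrightarrow> \<Lambda> f \<in> S"
proof -
  \<comment> \<open>Unbounded sequences get the value 0, so that every factor of the product
    \<open>K\<close> is compact and Tychonoff's theorem applies.\<close>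
  define ev :: "nat \<Rightarrow> (nat \<Rightarrow> complex) \<Rightarrow> complex"
    where "ev = (\<lambda>n f. if bounded (range f) then f n else 0)"
  define K :: "((nat \<Rightarrow> complex) \<Rightarrow> complex) set"
    where "K = (\<Pi>\<^sub>E f\<in>UNIV. if bounded (range f) then closure (range f) else {0})"
  have "compactin (product_topology (\<lambda>_. euclidean) UNIV) K"
    unfolding K_def compactin_PiE by (auto simp: compact_closure)
  then have "compact K"
    by (simp add: euclidean_product_topology compactin_euclidean_iff)
  moreover have "ev n \<in> K" for n
    using closure_subset by (fastforce simp: ev_def K_def)
  then have "eventually (\<lambda>L. L \<in> K) (filtermap ev sequentially)"
    by (simp add: eventually_filtermap)
  moreover have "filtermap ev sequentially \<noteq> bot" by (simp add: filtermap_bot_iff)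
  ultimately obtain \<Lambda> where \<Lambda>: "inf (nhds \<Lambda>) (filtermap ev sequentially) \<noteq> bot"
    using compact_filter[THEN iffD1, rule_format, of K "filtermap ev sequentially"] by auto
  \<comment> \<open>A closed condition that holds for almost all evaluations passes to the cluster
    point. Linearity and the location of the limit are such conditions, as coordinate projections
    are continuous.\<close>
  have key: "\<Lambda> \<in> T" if "closed T" "eventually (\<lambda>n. ev n \<in> T) sequentially" for T
  proof (rule ccontr)
    assume "\<Lambda> \<notin> T"
    then have "eventually (\<lambda>L. L \<in> - T) (nhds \<Lambda>)"
      using that(1) by (intro eventually_nhds_in_open) auto
    with that(2) have "eventually (\<lambda>_. False) (inf (nhds \<Lambda>) (filtermap ev sequentially))"
      unfolding eventually_inf
      by (intro exI[of _ "\<lambda>L. L \<in> - T"] exI[of _ "\<lambda>L. L \<in> T"]) (simp add: eventually_filtermap)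
    with \<Lambda> show False by (simp add: eventually_False)
  qed
  show thesis
  proof
    fix f g :: "nat \<Rightarrow> complex" assume b: "bounded (range f)" "bounded (range g)"
    then have b': "bounded (range (\<lambda>n. f n + g n))" by (rule bounded_plus_comp)
    have "\<Lambda> \<in> {L. L (\<lambda>n. f n + g n) = L f + L g}"
      by (rule key) (intro closed_Collect_eq continuous_on_add continuous_on_product_coordinates,
          simp add: ev_def b b')
    then show "\<Lambda> (\<lambda>n. f n + g n) = \<Lambda> f + \<Lambda> g" by simp
  next
    fix a and f :: "nat \<Rightarrow> complex" assume b: "bounded (range f)"
    then have b': "bounded (range (\<lambda>n. a * f n))"
      using bounded_linear_image[OF b bounded_linear_mult_right[of a]] by (simp add: image_image)
    have "\<Lambda> \<in> {L. L (\<lambda>n. a * f n) = a * L f}"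
      by (rule key) (intro closed_Collect_eq continuous_on_mult_left continuous_on_product_coordinates,
          simp add: ev_def b b')
    then show "\<Lambda> (\<lambda>n. a * f n) = a * \<Lambda> f" by simp
  next
    fix f :: "nat \<Rightarrow> complex" and S
    assume f: "bounded (range f)" "closed S" "eventually (\<lambda>n. f n \<in> S) sequentially"
    have "\<Lambda> \<in> (\<lambda>L. L f) -` S"
      by (rule key) (use f in \<open>simp_all add: ev_def closed_vimage\<close>)
    then show "\<Lambda> f \<in> S" by simp
  qed
qed

section \<open>The norms of \<open>N\<close> and membership in \<open>A\<close>\<close>

lemma dmat_carrier: "dmat c n \<in> carrier_mat n n" "dmat_inv c n \<in> carrier_mat n n"
  by (simp_all add: dmat_def dmat_inv_def)

lemma p_block_zero [simp]: "p_block c n (0\<^sub>m n n) = 0"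
proof -
  have z: "mat_opnorm (0\<^sub>m n n) = 0"
    using mat_opnorm_smult_le[of 0 "0\<^sub>m n n"] mat_opnorm_nonneg[of "0\<^sub>m n n"] by simp
  have "dmat c n * 0\<^sub>m n n * dmat_inv c n = 0\<^sub>m n n"
    by (simp only: right_mult_zero_mat[OF dmat_carrier(1)] left_mult_zero_mat[OF dmat_carrier(2)])
  with z show ?thesis by (simp add: p_block_def)
qed

lemma p_block_nonneg: "0 \<le> p_block c n X"
  unfolding p_block_def using mat_opnorm_nonneg[of X] by (rule max.coboundedI1)

lemma p_block_add_le:
  assumes "X \<in> carrier_mat n n" "Y \<in> carrier_mat n n"
  shows "p_block c n (X + Y) \<le> p_block c n X + p_block c n Y"
proof -
  note d = dmat_carrier[of c n]
  have "dmat c n * (X + Y) * dmat_inv c n = dmat c n * X * dmat_inv c n + dmat c n * Y * dmat_inv c n"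
    using assms d mult_add_distrib_mat[OF d(1) assms]
      add_mult_distrib_mat[of "dmat c n * X" n n "dmat c n * Y" "dmat_inv c n" n] by simp
  then show ?thesis
    using mat_opnorm_add_le[OF assms]
      mat_opnorm_add_le[OF dmat_conj_carrier[of c n X] dmat_conj_carrier[of c n Y]]
    by (auto simp: p_block_def max_def)
qed

lemma p_block_smult_le:
  assumes "X \<in> carrier_mat n n"
  shows "p_block c n (a \<cdot>\<^sub>m X) \<le> cmod a * p_block c n X"
proof -
  note d = dmat_carrier[of c n]
  have "dmat c n * (a \<cdot>\<^sub>m X) * dmat_inv c n = a \<cdot>\<^sub>m (dmat c n * X * dmat_inv c n)"
    using mult_smult_distrib[OF d(1) assms, of a]
      mult_smult_assoc_mat[OF mult_carrier_mat[OF d(1) assms] d(2), of a] by simp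
  then show ?thesis
    using order_trans[OF mat_opnorm_smult_le[of a X]] order_trans[OF mat_opnorm_smult_le[of a]]
    unfolding p_block_def by (simp add: mult_left_mono)
qed

lemma mem_carr_alg_N_iff:
  "x \<in> carr (alg_N c) \<longleftrightarrow>
     (\<forall>n. x n \<in> carrier_mat n n) \<and> bdd_above ((\<lambda>n. p_block c n (x n)) ` {1..})"
proof -
  have "bdd_above ((\<lambda>n. mat_opnorm (x n)) ` {1..})"
    if "bdd_above ((\<lambda>n. p_block c n (x n)) ` {1..})"
    using that unfolding bdd_above_def p_block_def by fastforce
  then show ?thesis
    by (auto simp: alg_N_def linf_M_def linf_MM_def p_block_def)
qed

lemma nrm_alg_N: "nrm (alg_N c) x = (SUP n\<in>{1..}. p_block c n (x n))"
  by (simp add: alg_N_def)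

lemma p_block_le_nrm:
  "\<lbrakk>x \<in> carr (alg_N c); 1 \<le> n\<rbrakk> \<Longrightarrow> p_block c n (x n) \<le> nrm (alg_N c) x"
  unfolding nrm_alg_N by (rule cSUP_upper) (auto simp: mem_carr_alg_N_iff)

lemma nrm_nonneg: "x \<in> carr (alg_N c) \<Longrightarrow> 0 \<le> nrm (alg_N c) x"
  using p_block_le_nrm[of x c 1] p_block_nonneg[of c 1 "x 1"] by linarith

text \<open>Membership in the carrier is not assumed, so this applies directly to differences such
  as \<open>x u\<^sub>k - x\<close>. The uniform bound makes the supremum meaningful.\<close>

lemma nrm_le:
  assumes "\<And>n. 1 \<le> n \<Longrightarrow> p_block c n (x n) \<le> C"
  shows "0 \<le> nrm (alg_N c) x" "nrm (alg_N c) x \<le> C"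
proof -
  have "bdd_above ((\<lambda>n. p_block c n (x n)) ` {1..})"
    using assms by (intro bdd_aboveI2) auto
  then have "p_block c 1 (x 1) \<le> nrm (alg_N c) x"
    unfolding nrm_alg_N by (intro cSUP_upper) auto
  then show "0 \<le> nrm (alg_N c) x" using p_block_nonneg order_trans by blast
  show "nrm (alg_N c) x \<le> C"
    unfolding nrm_alg_N using assms by (intro cSUP_least) auto
qed

lemma norm_entry_avg_le_nrm:
  assumes "x \<in> carr (alg_N c)"
  shows "cmod (entry_avg n (x n)) \<le> nrm (alg_N c) x"
proof (cases "n = 0")
  case True
  then show ?thesis using nrm_nonneg[OF assms] by (simp add: entry_avg_def)
next
  case False
  have "cmod (entry_avg n (x n)) \<le> p_block c n (x n)"
    using norm_entry_avg_le[of "x n" n] assms by (auto simp: mem_carr_alg_N_iff p_block_def)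
  also have "\<dots> \<le> nrm (alg_N c) x" using p_block_le_nrm[OF assms] False by simp
  finally show ?thesis .
qed

text \<open>Finitely many blocks cannot spoil boundedness. This matters because the estimates for
  shift polynomials require \<open>c n \<ge> 1\<close>, which may fail early on.\<close>

lemma mem_carr_alg_N_I:
  assumes "\<And>n. x n \<in> carrier_mat n n" "\<And>n. m \<le> n \<Longrightarrow> p_block c n (x n) \<le> C"
  shows "x \<in> carr (alg_N c)"
proof -
  have "p_block c n (x n) \<le> \<bar>C\<bar> + (\<Sum>i<m. p_block c i (x i))" for n
  proof (cases "n < m")
    case True
    then have "p_block c n (x n) \<le> (\<Sum>i<m. p_block c i (x i))"
      by (intro member_le_sum) (auto simp: p_block_nonneg)
    then show ?thesis by linarith
  next
    case False
    moreover have "0 \<le> (\<Sum>i<m. p_block c i (x i))" by (simp add: sum_nonneg p_block_nonneg)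
    ultimately show ?thesis using assms(2)[of n] by linarith
  qed
  then show ?thesis
    using assms(1) by (auto simp: mem_carr_alg_N_iff intro!: bdd_aboveI2)
qed

lemma carr_alg_A_D:
  assumes "x \<in> carr (alg_A c)"
  shows "x \<in> carr (alg_N c)" "x n \<in> carrier_mat n n"
  using assms by (auto simp: alg_A_def mem_carr_alg_N_iff)

lemma alg_A_simps [simp]:
  "add (alg_A c) x y = (\<lambda>n. x n + y n)" "scl (alg_A c) a x = (\<lambda>n. a \<cdot>\<^sub>m x n)"
  "mul (alg_A c) x y = (\<lambda>n. x n * y n)" "nrm (alg_A c) = nrm (alg_N c)"
  by (simp_all add: alg_A_def alg_N_def)

text \<open>Reduces the limit of the two suprema to estimates in single blocks that are uniform in
  \<open>n\<close>, by squeezing.\<close>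

lemma mem_carr_alg_A_I:
  assumes x: "x \<in> carr (alg_N c)" and "e \<longlonglongrightarrow> 0"
    and "eventually (\<lambda>k. \<forall>n\<ge>1. p_block c n (x n * u_block n k - x n) \<le> e k \<and>
      p_block c n (u_block n k * x n - x n) \<le> e k) sequentially"
  shows "x \<in> carr (alg_A c)"
proof -
  let ?f = "\<lambda>k. nrm (alg_N c) (\<lambda>n. x n * useq k n - x n) + nrm (alg_N c) (\<lambda>n. useq k n * x n - x n)"
  have *: "eventually (\<lambda>k. 0 \<le> ?f k \<and> ?f k \<le> 2 * e k) sequentially"
    using assms(3)
  proof (rule eventually_mono)
    fix k assume k: "\<forall>n\<ge>1. p_block c n (x n * u_block n k - x n) \<le> e k \<and>
      p_block c n (u_block n k * x n - x n) \<le> e k"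
    have r: "\<And>n. 1 \<le> n \<Longrightarrow> p_block c n (x n * useq k n - x n) \<le> e k"
      and l: "\<And>n. 1 \<le> n \<Longrightarrow> p_block c n (useq k n * x n - x n) \<le> e k"
      using k by (simp_all add: useq_def)
    show "0 \<le> ?f k \<and> ?f k \<le> 2 * e k"
      using nrm_le[of c _ "e k", OF r] nrm_le[of c _ "e k", OF l] by linarith
  qed
  have "eventually (\<lambda>k. 0 \<le> ?f k) sequentially" "eventually (\<lambda>k. ?f k \<le> 2 * e k) sequentially"
    using * by (auto elim: eventually_mono)
  moreover have "(\<lambda>k. 2 * e k) \<longlonglongrightarrow> 0" using tendsto_mult_left[OF assms(2), of 2] by simp
  ultimately have "?f \<longlonglongrightarrow> 0"
    by (rule tendsto_sandwich[OF _ _ tendsto_const])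
  with x show ?thesis by (simp add: alg_A_def)
qed

lemma u_block_carrier [simp]: "u_block n k \<in> carrier_mat n n"
  by (simp add: u_block_eq)

lemma u_block_id: "n < k \<Longrightarrow> u_block n k = 1\<^sub>m n"
  by (simp add: u_block_def)

lemma u_block_residual_eq_zero:
  assumes "X \<in> carrier_mat n n" "n < k \<or> X = 0\<^sub>m n n"
  shows "X * u_block n k - X = 0\<^sub>m n n" "u_block n k * X - X = 0\<^sub>m n n"
proof -
  have "X * u_block n k = X" "u_block n k * X = X"
    using assms by (auto simp: u_block_id left_mult_zero_mat[OF u_block_carrier] right_mult_zero_mat[OF u_block_carrier])
  then show "X * u_block n k - X = 0\<^sub>m n n" "u_block n k * X - X = 0\<^sub>m n n"
    using minus_r_inv_mat[OF assms(1)] by simp_all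
qed

text \<open>For \<open>k > m\<close> every block of \<open>u\<^sub>k\<close> that meets the support
  is an identity matrix, so both residuals vanish exactly.\<close>

lemma finite_support_mem_carr_alg_A:
  assumes "\<And>n. x n \<in> carrier_mat n n" "\<And>n. m < n \<Longrightarrow> x n = 0\<^sub>m n n"
  shows "x \<in> carr (alg_A c)"
proof (rule mem_carr_alg_A_I)
  show "x \<in> carr (alg_N c)"
    using assms by (intro mem_carr_alg_N_I[of x "Suc m" c 0]) auto
  have "x n * u_block n k - x n = 0\<^sub>m n n \<and> u_block n k * x n - x n = 0\<^sub>m n n" if "m < k" for n k
    using that assms(1)[of n] assms(2)[of n]
    by (intro conjI u_block_residual_eq_zero) (cases "m < n"; auto)+
  then show "eventually (\<lambda>k. \<forall>n\<ge>1. p_block c n (x n * u_block n k - x n) \<le> 0 \<and>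
      p_block c n (u_block n k * x n - x n) \<le> 0) sequentially"
    by (intro eventually_mono[OF eventually_gt_at_top[of m]]) simp
qed simp

text \<open>Blocks with \<open>n < k\<close> have no residual. The others have
  \<open>n \<ge> k \<ge> N\<close> for large \<open>k\<close>, so \<open>c n \<ge> 1\<close> and the
  absorption estimate applies.\<close>

lemma restricted_u_mem_carr_alg_A:
  assumes c: "\<And>n. 1 \<le> n \<Longrightarrow> 0 < c n" "\<And>n. N \<le> n \<Longrightarrow> 1 \<le> c n" and N: "1 \<le> N" and m: "1 \<le> m"
  shows "(\<lambda>n. if n \<in> S then u_block n m else 0\<^sub>m n n) \<in> carr (alg_A c)" (is "?x \<in> _")
proof (rule mem_carr_alg_A_I)
  have p: "p_block c n (toeplitz_poly n q) \<le> ell1 n q" if "N \<le> n" for n q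
    using c that N by (intro p_block_toeplitz_le) auto
  show "?x \<in> carr (alg_N c)"
  proof (rule mem_carr_alg_N_I)
    fix n assume "N \<le> n"
    then show "p_block c n (?x n) \<le> 1"
      using order_trans[OF p ell1_u_poly_le] by (simp add: u_block_eq)
  qed simp
  show "(\<lambda>k. 8 * real m / real k) \<longlonglongrightarrow> 0"
    by (rule lim_const_over_n)
  show "eventually (\<lambda>k. \<forall>n\<ge>1. p_block c n (?x n * u_block n k - ?x n) \<le> 8 * real m / real k \<and>
      p_block c n (u_block n k * ?x n - ?x n) \<le> 8 * real m / real k) sequentially"
    using eventually_ge_at_top[of "max N (2 * m)"]
  proof eventually_elim
    case (elim k)
    have "p_block c n (?x n * u_block n k - ?x n) \<le> 8 * real m / real k \<and>
      p_block c n (u_block n k * ?x n - ?x n) \<le> 8 * real m / real k" for n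
    proof (cases "n \<in> S \<and> k \<le> n")
      case True
      \<comment> \<open>Polynomials in the shift commute, so the left and right residuals
        coincide.\<close>
      have *: "u_block n m * u_block n k - u_block n m = toeplitz_poly n (u_poly n m * u_poly n k - u_poly n m)"
        "u_block n k * u_block n m - u_block n m = toeplitz_poly n (u_poly n m * u_poly n k - u_poly n m)"
        by (simp_all only: u_block_eq toeplitz_poly_diff toeplitz_poly_mult[symmetric] mult.commute)
      have "p_block c n (toeplitz_poly n (u_poly n m * u_poly n k - u_poly n m)) \<le> 8 * real m / real k"
        using elim True m by (intro order_trans[OF p ell1_u_poly_absorb]) auto
      then show ?thesis using True by (simp only: * simp_thms if_True)
    next
      case False
      then have "?x n * u_block n k - ?x n = 0\<^sub>m n n" "u_block n k * ?x n - ?x n = 0\<^sub>m n n"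
        by (intro u_block_residual_eq_zero; auto)+
      then show ?thesis by (simp only: p_block_zero) simp
    qed
    then show ?case by blast
  qed
qed

section \<open>Functionals on \<open>A\<close>\<close>

lemma entry_avg_bounded_functional:
  "(\<lambda>x. entry_avg n (x n)) \<in> bounded_functionals (alg_A c)"
proof -
  have "x n \<in> carrier_mat n n" if "x \<in> carr (alg_A c)" for x :: "nat \<Rightarrow> complex mat"
    using that by (rule carr_alg_A_D)
  moreover have "\<forall>x\<in>carr (alg_A c). cmod (entry_avg n (x n)) \<le> 1 * nrm (alg_A c) x"
    by (simp add: norm_entry_avg_le_nrm carr_alg_A_D(1))
  ultimately show ?thesis
    unfolding bounded_functionals_def
    by (auto simp: entry_avg_add entry_avg_smult simp del: mult_1 intro!: exI[of _ 1])
qed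

lemma generalized_limit_bounded_functional:
  assumes add: "\<And>f g. \<lbrakk>bounded (range f); bounded (range g)\<rbrakk> \<Longrightarrow> \<Lambda> (\<lambda>n. f n + g n) = \<Lambda> f + \<Lambda> g"
    and scl: "\<And>a f. bounded (range f) \<Longrightarrow> \<Lambda> (\<lambda>n. a * f n) = a * \<Lambda> f"
    and mem: "\<And>f S. \<lbrakk>bounded (range f); closed S; eventually (\<lambda>n. f n \<in> S) sequentially\<rbrakk> \<Longrightarrow> \<Lambda> f \<in> S"
  shows "(\<lambda>x. \<Lambda> (\<lambda>n. entry_avg n (x n))) \<in> bounded_functionals (alg_A c)"
proof -
  have x: "x n \<in> carrier_mat n n" "cmod (entry_avg n (x n)) \<le> nrm (alg_A c) x"
    if "x \<in> carr (alg_A c)" for x n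
    using carr_alg_A_D[OF that] by (simp_all add: norm_entry_avg_le_nrm)
  then have b: "bounded (range (\<lambda>n. entry_avg n (x n)))" if "x \<in> carr (alg_A c)" for x
    using that by (intro boundedI) auto
  \<comment> \<open>Boundedness comes from the closed ball that contains all the averages of
    \<open>x\<close>.\<close>
  have "\<Lambda> (\<lambda>n. entry_avg n (x n)) \<in> cball 0 (nrm (alg_A c) x)" if "x \<in> carr (alg_A c)" for x
    using that x b by (intro mem) auto
  then have "\<forall>x\<in>carr (alg_A c). cmod (\<Lambda> (\<lambda>n. entry_avg n (x n))) \<le> 1 * nrm (alg_A c) x"
    by simp
  then show ?thesis
    unfolding bounded_functionals_def
    using x(1) b by (auto simp: entry_avg_add entry_avg_smult add scl simp del: mult_1 intro!: exI[of _ 1])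
qed

lemma openin_weak_topology:
  "\<lbrakk>\<phi> \<in> bounded_functionals E; open U\<rbrakk> \<Longrightarrow> openin (weak_topology E) {x \<in> carr E. \<phi> x \<in> U}"
  unfolding weak_topology_def by (rule topology_generated_by_Basis) blast

lemma topspace_weak_topology_subset: "topspace (weak_topology E) \<subseteq> carr E"
  unfolding weak_topology_def by auto

section \<open>Failure of weak compactness and of separability\<close>

lemma not_weakly_compact_alg_A:
  assumes c: "\<And>n. 1 \<le> n \<Longrightarrow> 0 < c n" "\<And>n. N \<le> n \<Longrightarrow> 1 \<le> c n" "1 \<le> N"
  shows "\<not> weakly_compact_algebra (alg_A c)"
proof
  let ?A = "alg_A c"
  let ?W = "weak_topology ?A"
  define a where "a = (\<lambda>n. u_block n 8)"
  define T where "T = (\<lambda>x n. a n * x n * a n)"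
  define B where "B = {x \<in> carr ?A. nrm ?A x \<le> 1}"
  define x where "x = (\<lambda>j n. if n \<le> j then 1\<^sub>m n else 0\<^sub>m n n :: complex mat)"
  have "a \<in> carr ?A"
    using restricted_u_mem_carr_alg_A[where S = UNIV and c = c and N = N and m = 8] c by (simp add: a_def)
  moreover assume "weakly_compact_algebra ?A"
  ultimately have K: "compactin ?W (?W closure_of (T ` B))" (is "compactin _ ?K")
    by (auto simp: weakly_compact_algebra_def weakly_compact_operator_def T_def B_def)
  obtain \<Lambda> :: "(nat \<Rightarrow> complex) \<Rightarrow> complex" where
    \<Lambda>: "\<And>f g. \<lbrakk>bounded (range f); bounded (range g)\<rbrakk> \<Longrightarrow> \<Lambda> (\<lambda>n. f n + g n) = \<Lambda> f + \<Lambda> g"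
      "\<And>a f. bounded (range f) \<Longrightarrow> \<Lambda> (\<lambda>n. a * f n) = a * \<Lambda> f"
      "\<And>f S. \<lbrakk>bounded (range f); closed S; eventually (\<lambda>n. f n \<in> S) sequentially\<rbrakk> \<Longrightarrow> \<Lambda> f \<in> S"
    by (rule generalized_limit_exists) blast
  define \<phi> where "\<phi> = (\<lambda>n x. entry_avg n (x n :: complex mat))"
  define L where "L = (\<lambda>x. \<Lambda> (\<lambda>n. \<phi> n x))"
  \<comment> \<open>\<open>b n\<close> is the value of \<open>\<phi> n\<close> at
    \<open>T (x j)\<close> for every \<open>j \<ge> n\<close>.\<close>
  define b where "b = (\<lambda>n. entry_avg n (a n * a n))"
  \<comment> \<open>The threshold lies between 0, the value of \<open>L\<close> at each
    \<open>T (x j)\<close>, and 1/2, the lower bound forced by \<open>\<phi> n y = b n\<close> for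
    all \<open>n\<close>.\<close>
  define V where "V = {y \<in> carr ?A. L y \<in> {z. 1 / 4 < Re z}}"
  define O' where "O' = (\<lambda>n. {y \<in> carr ?A. \<phi> n y \<in> - {b n}})"
  have oV: "openin ?W V"
    unfolding V_def L_def \<phi>_def
    by (rule openin_weak_topology[OF generalized_limit_bounded_functional[OF \<Lambda>]],
        assumption+, intro open_Collect_less continuous_intros)
  have oO: "openin ?W (O' n)" for n
    unfolding O'_def \<phi>_def by (intro openin_weak_topology entry_avg_bounded_functional) auto
  have cover: "?K \<subseteq> \<Union> (insert V (range O'))"
  proof
    fix y assume "y \<in> ?K"
    then have y: "y \<in> carr ?A"
      using subset_trans[OF compactin_subset_topspace[OF K] topspace_weak_topology_subset] by blast
    show "y \<in> \<Union> (insert V (range O'))"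
    proof (cases "\<forall>n. \<phi> n y = b n")
      case True
      have bnd: "bounded (range (\<lambda>n. \<phi> n y))"
        using norm_entry_avg_le_nrm[OF carr_alg_A_D(1)[OF y]] unfolding \<phi>_def
        by (intro boundedI[where B = "nrm (alg_N c) y"]) auto
      have ev: "eventually (\<lambda>n. \<phi> n y \<in> {z. 1 / 2 \<le> Re z}) sequentially"
        by (rule eventually_mono[OF eventually_ge_at_top[of 1]])
          (simp only: mem_Collect_eq True b_def a_def Re_entry_avg_u_block(2))
      have "closed {z. 1 / 2 \<le> Re z}"
        by (intro closed_Collect_le continuous_intros)
      then have "L y \<in> {z. 1 / 2 \<le> Re z}"
        unfolding L_def by (rule \<Lambda>(3)[OF bnd _ ev])
      then show ?thesis using y by (simp add: V_def)
    qed (use y in \<open>auto simp: O'_def\<close>)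
  qed
  have "\<exists>F. finite F \<and> F \<subseteq> insert V (range O') \<and> ?K \<subseteq> \<Union> F"
    by (rule compactinD[OF K _ cover]) (use oV oO in auto)
  then obtain F where F: "finite F" "F \<subseteq> insert V (range O')" "?K \<subseteq> \<Union> F"
    by (elim exE conjE)
  obtain I where I: "finite I" "F \<subseteq> insert V (O' ` I)"
  proof -
    have "finite (F - {V})" "F - {V} \<subseteq> range O'" using F(1,2) by auto
    then have "\<exists>I. I \<subseteq> UNIV \<and> finite I \<and> F - {V} = O' ` I"
      by (rule finite_subset_image)
    then show ?thesis
    proof (elim exE conjE)
      fix I assume "finite I" "F - {V} = O' ` I"
      then show thesis by (intro that[of I]) auto
    qed
  qed
  \<comment> \<open>With \<open>j\<close> beyond all of \<open>I\<close>, the point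
    \<open>T (x j)\<close> takes the excluded value \<open>b n\<close> for each \<open>n\<close> in
    \<open>I\<close>, and so avoids these \<open>O' n\<close>.\<close>
  obtain j where j: "\<And>n. n \<in> I \<Longrightarrow> n \<le> j"
    using I(1) by (auto simp: finite_nat_set_iff_bounded_le)
  have xj: "x j \<in> B"
  proof -
    have "x j \<in> carr ?A"
      by (rule finite_support_mem_carr_alg_A[of _ j]) (auto simp: x_def)
    moreover have "nrm ?A (x j) \<le> 1"
    proof -
      \<comment> \<open>The identity has a single nonzero coefficient, in degree 0, so this also
        holds where \<open>c n < 1\<close>.\<close>
      have "p_block c n (1\<^sub>m n) \<le> 1" if "1 \<le> n" for n
        using p_block_toeplitz_le[of c n "coeff 1"] c(1)[OF that] that
        by (simp add: toeplitz_poly_1 sum.delta if_distrib[of abs] cong: if_cong)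
      then show ?thesis by (simp add: nrm_le x_def)
    qed
    ultimately show ?thesis by (simp add: B_def)
  qed
  define y where "y = T (x j)"
  have y: "y n = (if n \<le> j then a n * a n else 0\<^sub>m n n)" for n
    by (simp add: y_def T_def x_def a_def right_mult_one_mat[OF u_block_carrier]
        right_mult_zero_mat[OF u_block_carrier] left_mult_zero_mat[OF u_block_carrier])
  have yA: "y \<in> carr ?A"
    by (rule finite_support_mem_carr_alg_A[of _ j]) (simp_all add: y a_def mult_carrier_mat[of _ n n _ n for n])
  \<comment> \<open>The preimage of \<open>UNIV\<close> under any bounded functional is the whole
    carrier, which is therefore open.\<close>
  then have "y \<in> topspace ?W"
    using openin_subset[OF openin_weak_topology[of "\<lambda>x. entry_avg 0 (x 0)" ?A UNIV]]
      entry_avg_bounded_functional by auto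
  then have "y \<in> ?K"
    using closure_of_subset_Int[of ?W "T ` B"] xj by (auto simp: y_def)
  with F(3) obtain U where U: "U \<in> F" "y \<in> U" by (meson UnionE subsetD)
  from subsetD[OF I(2) U(1)] U(2) have "y \<in> V \<or> (\<exists>n\<in>I. y \<in> O' n)" by auto
  moreover have "y \<notin> O' n" if "n \<in> I" for n
    using j[OF that] by (simp add: O'_def \<phi>_def y b_def)
  moreover have "L y = 0"
  proof -
    have bnd: "bounded (range (\<lambda>n. \<phi> n y))"
      using norm_entry_avg_le_nrm[OF carr_alg_A_D(1)[OF yA]] unfolding \<phi>_def
      by (intro boundedI[where B = "nrm (alg_N c) y"]) auto
    have ev: "eventually (\<lambda>n. \<phi> n y \<in> {0}) sequentially"
      using eventually_gt_at_top[of j] by eventually_elim (simp add: \<phi>_def y)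
    from \<Lambda>(3)[OF bnd closed_singleton ev] show ?thesis by (simp add: L_def)
  qed
  ultimately show False by (simp add: V_def)
qed

lemma not_separable_alg_A:
  assumes c: "\<And>n. 1 \<le> n \<Longrightarrow> 0 < c n" "\<And>n. N \<le> n \<Longrightarrow> 1 \<le> c n" "1 \<le> N"
  shows "\<not> separable_algebra (alg_A c)"
proof
  let ?A = "alg_A c"
  \<comment> \<open>The shift by \<open>Suc\<close> lets \<open>S\<close> range over all sets of
    naturals while avoiding block 0, which carries no information.\<close>
  define a where "a = (\<lambda>S n. if n \<in> Suc ` S then u_block n 8 else 0\<^sub>m n n)"
  define ball where "ball = (\<lambda>x. {y \<in> carr ?A. nrm ?A (add ?A y (scl ?A (-1) x)) < 1 / 8})"
  have aA: "a S \<in> carr ?A" for S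
    unfolding a_def using c by (intro restricted_u_mem_carr_alg_A) auto
  have carr: "x n \<in> carrier_mat n n" if "x \<in> carr ?A" for x n
    using that by (rule carr_alg_A_D)
  have oball: "openin (norm_topology ?A) (ball (a S))" for S
    unfolding norm_topology_def ball_def using aA by (intro topology_generated_by_Basis) blast
  have near: "cmod (entry_avg n (y n) - entry_avg n (x n)) < 1 / 8"
    if x: "x \<in> carr ?A" and y: "y \<in> ball x" for x y n
  proof -
    have yA: "y \<in> carr ?A" using y by (simp add: ball_def)
    let ?z = "\<lambda>n. y n + (-1) \<cdot>\<^sub>m x n"
    have "?z \<in> carr (alg_N c)"
    proof -
      have "p_block c n (?z n) \<le> nrm ?A y + nrm ?A x" if "1 \<le> n" for n
      proof -
        have "p_block c n (?z n) \<le> p_block c n (y n) + p_block c n ((-1) \<cdot>\<^sub>m x n)"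
          using carr[OF x] carr[OF yA] by (intro p_block_add_le) auto
        moreover have "p_block c n ((-1) \<cdot>\<^sub>m x n) \<le> p_block c n (x n)"
          using p_block_smult_le[OF carr[OF x], of c n "-1"] by simp
        ultimately show ?thesis
          using p_block_le_nrm[OF carr_alg_A_D(1)[OF yA] that]
            p_block_le_nrm[OF carr_alg_A_D(1)[OF x] that] by simp
      qed
      then show ?thesis
        using carr[OF x] carr[OF yA] by (intro mem_carr_alg_N_I[of _ 1]) auto
    qed
    then have "cmod (entry_avg n (?z n)) < 1 / 8"
      using norm_entry_avg_le_nrm[of ?z c n] y by (simp add: ball_def)
    then show ?thesis
      using carr[OF x, of n] carr[OF yA, of n] by (simp add: entry_avg_add[of _ n] entry_avg_smult)
  qed
  assume "separable_algebra ?A"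
  then obtain C where C: "countable C" "norm_topology ?A closure_of C = topspace (norm_topology ?A)"
    unfolding separable_algebra_def separable_space_def by blast
  have "\<exists>d. d \<in> C \<and> d \<in> ball (a S)" for S
  proof -
    have "nrm ?A (\<lambda>n. a S n + (-1) \<cdot>\<^sub>m a S n) \<le> 0"
    proof -
      have "a S n + (-1) \<cdot>\<^sub>m a S n = 0\<^sub>m n n" for n
        using carr[OF aA, of S n] by (intro eq_matI) auto
      then show ?thesis by (simp add: nrm_le)
    qed
    then have "a S \<in> ball (a S)" using aA by (simp add: ball_def)
    moreover from this have "a S \<in> norm_topology ?A closure_of C"
      using openin_subset[OF oball, of S] C(2) by blast
    ultimately show ?thesis using oball unfolding in_closure_of by blast
  qed
  then obtain g where g: "\<And>S. g S \<in> C" "\<And>S. g S \<in> ball (a S)" by metis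
  \<comment> \<open>A common approximant would have, in a block of \<open>S\<close> outside
    \<open>S'\<close>, an average within 1/8 both of 0 and of a number of modulus at least
    1/2.\<close>
  have sub: "S \<subseteq> S'" if "g S = g S'" for S S'
  proof
    fix n assume n: "n \<in> S"
    let ?n = "Suc n"
    show "n \<in> S'"
    proof (rule ccontr)
      assume "n \<notin> S'"
      then have "a S' ?n = 0\<^sub>m ?n ?n" by (auto simp: a_def)
      then have "cmod (entry_avg ?n (g S ?n)) < 1 / 8"
        using near[OF aA g(2)[of S'], of ?n] that by simp
      moreover have "cmod (entry_avg ?n (g S ?n) - entry_avg ?n (u_block ?n 8)) < 1 / 8"
        using near[OF aA g(2)[of S], of ?n] n by (simp add: a_def)
      moreover have "1 / 2 \<le> cmod (entry_avg ?n (u_block ?n 8))"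
        using Re_entry_avg_u_block(1)[of ?n] complex_Re_le_cmod order_trans by (metis le_add1 plus_1_eq_Suc)
      ultimately show False
        using norm_triangle_ineq2[of "entry_avg ?n (u_block ?n 8)" "entry_avg ?n (g S ?n)"]
        by (simp add: norm_minus_commute)
    qed
  qed
  \<comment> \<open>Equal values of \<open>g\<close> give both inclusions, so the power set of the
    naturals would embed into the countable set \<open>C\<close>.\<close>
  have "inj g" using sub by (intro injI equalityI) metis+
  moreover have "countable (range g)"
    by (rule countable_subset[OF _ C(1)]) (use g(1) in auto)
  ultimately have "countable (UNIV :: nat set set)"
    by (rule countable_image_inj_on[rotated])
  then have "range (from_nat_into (UNIV :: nat set set)) = UNIV"
    by (intro range_from_nat_into) auto
  then show False using Cantors_theorem[of "UNIV :: nat set"] by auto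
qed

theorem theorem2p5:
  fixes c :: "nat \<Rightarrow> real"
  assumes "\<And>n. 1 \<le> n \<Longrightarrow> 0 < c n"
    and "mono_on {1..} c"
    and "\<not> bdd_above (c ` {1..})"
  shows "\<not> weakly_compact_algebra (alg_A c) \<and> \<not> separable_algebra (alg_A c)"
proof -
  \<comment> \<open>Unboundedness gives one index with \<open>c N \<ge> 1\<close>, and monotonicity
    passes this on to all later blocks.\<close>
  obtain N where N: "1 \<le> N" "1 \<le> c N"
    using assms(3) unfolding bdd_above_def by (metis atLeast_iff imageE linear)
  then have "1 \<le> c n" if "N \<le> n" for n
    using mono_onD[OF assms(2), of N n] that by auto
  with N assms(1) show ?thesis
    using not_weakly_compact_alg_A not_separable_alg_A by blast
qed

end
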